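(* Let $n\ge1$, $j\in[n]$, and $M\subseteq[n]\setminus\{j\}$. Consider the system $$\ell(J,(M\cup\{j\})\setminus J)\ge0\quad\forall J\subseteq M\cup\{j\},\qquad \begin{bmatrix}\ell(J,M\setminus J)&\ell(J\cup\{j\},M\setminus J)\\ \ell(J\cup\{j\},M\setminus J)&\rho(j,J,M\setminus J)\end{bmatrix}\succeq0\quad\forall J\subseteq M,$$ in the variables $z_S$ ($\emptyset\ne S\subseteq M\cup\{j\}$), $z_{jj}$, and $z_{jj}^J$ ($\emptyset\neq J\subseteq M$). Then the projection of its solution set onto the space of the variables $z_S$ ($\emptyset\neq S\subseteq M\cup\{j\}$) and $z_{jj}$, i.e., the set obtained by projecting out $z_{jj}^J$ for all nonempty $J\subseteq M$, is given by the inequalities $$\ell(J,(M\cup\{j\})\setminus J)\ge0\quad\forall J\subseteq M\cup\{j\},\qquad z_{jj}\ \ge\ \sum_{J\subseteq M}\frac{\big(\ell(J\cup\{j\},M\setminus J)\big)^2}{\ell(J,M\setminus J)}.$$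
   Context: $[n]=\{1,\dots,n\}$. For each nonempty $S\subseteq M\cup\{j\}$ there is a real variable $z_S$ and $z_\emptyset:=1$. For each $J\subseteq M$ there is a real variable $z_{jj}^J$, with $z_{jj}^\emptyset:=z_{jj}$. For disjoint $J_1,J_2$, $$\ell(J_1,J_2):=\sum_{t\subseteq J_2}(-1)^{|t|}z_{J_1\cup t},\qquad \rho(j,J_1,J_2):=\sum_{t\subseteq J_2}(-1)^{|t|}z_{jj}^{J_1\cup t}\quad (j\notin J_1\cup J_2).$$ In fractions the convention $\tfrac00:=0$ is used. *)

theory Defs
  imports "HOL-Analysis.Analysis" "HOL-Library.FuncSet"
begin

text \<open>
  A family of real variables indexed by the nonempty subsets of \<open>A\<close> is a point of
  \<open>var_space A\<close>; extensionality makes it carry no other coordinates.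
\<close>
definition var_space :: "nat set \<Rightarrow> (nat set \<Rightarrow> real) set"
  where "var_space A = (Pow A - {{}}) \<rightarrow>\<^sub>E UNIV"

definition with_empty :: "real \<Rightarrow> (nat set \<Rightarrow> real) \<Rightarrow> nat set \<Rightarrow> real"
  where "with_empty c z S = (if S = {} then c else z S)"

text \<open>The convention \<open>z\<^sub>\<emptyset> = 1\<close> is built into \<open>ell\<close>.\<close>
definition ell :: "(nat set \<Rightarrow> real) \<Rightarrow> nat set \<Rightarrow> nat set \<Rightarrow> real"
  where "ell z J1 J2 = (\<Sum>t\<in>Pow J2. (-1) ^ card t * with_empty 1 z (J1 \<union> t))"

text \<open>
  Here \<open>zjj\<close> is the variable \<open>z\<^sub>j\<^sub>j\<close> and \<open>w J\<close> is the variable with subscript \<open>jj\<close> and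
  superscript \<open>J\<close>, the index \<open>j\<close> being fixed; for \<open>J = {}\<close> the latter means \<open>zjj\<close>.
\<close>
definition rho :: "real \<Rightarrow> (nat set \<Rightarrow> real) \<Rightarrow> nat set \<Rightarrow> nat set \<Rightarrow> real"
  where "rho zjj w J1 J2 = (\<Sum>t\<in>Pow J2. (-1) ^ card t * with_empty zjj w (J1 \<union> t))"

definition psd :: "real ^ 'n ^ 'n \<Rightarrow> bool"
  where "psd A \<longleftrightarrow> transpose A = A \<and> (\<forall>x. 0 \<le> x \<bullet> (A *v x))"

definition lifted_set ::
    "nat \<Rightarrow> nat set \<Rightarrow> ((nat set \<Rightarrow> real) \<times> real \<times> (nat set \<Rightarrow> real)) set"
  where "lifted_set j M = {(z, zjj, w).
     z \<in> var_space (M \<union> {j}) \<and> w \<in> var_space M \<and>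
     (\<forall>J. J \<subseteq> M \<union> {j} \<longrightarrow> ell z J ((M \<union> {j}) - J) \<ge> 0) \<and>
     (\<forall>J. J \<subseteq> M \<longrightarrow>
        psd (vector [vector [ell z J (M - J), ell z (J \<union> {j}) (M - J)],
                     vector [ell z (J \<union> {j}) (M - J), rho zjj w J (M - J)]] :: real ^ 2 ^ 2))}"

text \<open>
  Division by zero yields \<open>0\<close> in HOL, which agrees with the convention \<open>0/0 = 0\<close>. A nonzero
  numerator over a zero denominator does not occur in this set: for \<open>J \<subseteq> M\<close> and \<open>j \<notin> M\<close>,
  \<open>ell z J (M - J) = ell z (J \<union> {j}) (M - J) + ell z J ((M \<union> {j}) - J)\<close>, and both
  summands are nonnegative by the linear inequalities.
\<close>
definition projected_set :: "nat \<Rightarrow> nat set \<Rightarrow> ((nat set \<Rightarrow> real) \<times> real) set"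
  where "projected_set j M = {(z, zjj).
     z \<in> var_space (M \<union> {j}) \<and>
     (\<forall>J. J \<subseteq> M \<union> {j} \<longrightarrow> ell z J ((M \<union> {j}) - J) \<ge> 0) \<and>
     zjj \<ge> (\<Sum>J\<in>Pow M. (ell z (J \<union> {j}) (M - J))\<^sup>2 / ell z J (M - J))}"

end

theory Submission
  imports Defs
begin

text \<open>
  A 2x2 symmetric matrix with rows \<open>(a, b)\<close> and \<open>(b, c)\<close>, where \<open>a = 0\<close> forces \<open>b = 0\<close>, is
  positive semidefinite iff \<open>a \<ge> 0\<close> and \<open>c \<ge> b\<^sup>2 / a\<close>. By Moebius inversion on the subset
  lattice of \<open>M\<close>, the numbers \<open>\<rho>(j, J, M - J)\<close> can be prescribed freely subject to the single
  constraint that their sum is \<open>z\<^sub>j\<^sub>j\<close>. Hence the lift exists iff \<open>z\<^sub>j\<^sub>j\<close> is at least the sum of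
  the lower bounds \<open>b\<^sup>2 / a\<close>.
\<close>

text \<open>Expanding the product of \<open>-1 + 1\<close> over all elements of \<open>A\<close>
  gives the alternating sum, so it equals \<open>0 ^ card A\<close>.\<close>

lemma sum_alternating_Pow:
  assumes "finite A"
  shows "(\<Sum>t\<in>Pow A. (-1) ^ card t :: 'a::comm_ring_1) = (if A = {} then 1 else 0)"
  using prod_add[OF assms, of "\<lambda>_. -1 :: 'a" "\<lambda>_. 1", symmetric] assms
  by (simp add: power_0_left)

text \<open>Regrouped by \<open>S = J \<union> t\<close>, each \<open>S \<subseteq> M\<close> is
  paired with every \<open>t \<subseteq> S\<close>, so the signs cancel unless \<open>S\<close> is
  empty.\<close>

lemma sum_alternating_complements:
  fixes f :: "'b set \<Rightarrow> 'a::comm_ring_1"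
  assumes "finite M"
  shows "(\<Sum>J\<in>Pow M. \<Sum>t\<in>Pow (M - J). (-1) ^ card t * f (J \<union> t)) = f {}"
proof -
  have "(\<Sum>J\<in>Pow M. \<Sum>t\<in>Pow (M - J). (-1) ^ card t * f (J \<union> t))
      = (\<Sum>(J, t)\<in>Sigma (Pow M) (\<lambda>J. Pow (M - J)). (-1) ^ card t * f (J \<union> t))"
    using assms by (subst sum.Sigma) auto
  also have "\<dots> = (\<Sum>(S, t)\<in>Sigma (Pow M) Pow. (-1) ^ card t * f S)"
    by (rule sum.reindex_bij_witness[where i = "\<lambda>(S, t). (S - t, t)"
          and j = "\<lambda>(J, t). (J \<union> t, t)"]) (auto simp: Un_absorb2)
  also have "\<dots> = (\<Sum>S\<in>Pow M. \<Sum>t\<in>Pow S. (-1) ^ card t * f S)"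
    using assms by (subst sum.Sigma) (auto intro: finite_subset)
  also have "\<dots> = (\<Sum>S\<in>Pow M. if S = {} then f S else 0)"
    using assms
    by (intro sum.cong refl)
      (auto simp: sum_alternating_Pow finite_subset simp flip: sum_distrib_right)
  also have "\<dots> = f {}"
    using assms by (simp add: sum.delta)
  finally show ?thesis .
qed

text \<open>After swapping the sums, \<open>r K\<close> is weighted by the alternating sum over the
  subsets of \<open>K - J\<close>, which vanishes unless \<open>K = J\<close>.\<close>

lemma moebius_supersets:
  fixes r :: "'b set \<Rightarrow> 'a::comm_ring_1"
  assumes "finite M" and "J \<subseteq> M"
  shows "(\<Sum>t\<in>Pow (M - J). (-1) ^ card t * (\<Sum>K | J \<union> t \<subseteq> K \<and> K \<subseteq> M. r K)) = r J"
proof -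
  have "(\<Sum>t\<in>Pow (M - J). (-1) ^ card t * (\<Sum>K | J \<union> t \<subseteq> K \<and> K \<subseteq> M. r K))
      = (\<Sum>t\<in>Pow (M - J). \<Sum>K | K \<in> {K. J \<subseteq> K \<and> K \<subseteq> M} \<and> t \<subseteq> K. (-1) ^ card t * r K)"
    unfolding sum_distrib_left by (intro sum.cong) auto
  also have "\<dots> = (\<Sum>K\<in>{K. J \<subseteq> K \<and> K \<subseteq> M}. \<Sum>t | t \<in> Pow (M - J) \<and> t \<subseteq> K. (-1) ^ card t * r K)"
    using assms by (intro sum.swap_restrict) (auto intro: finite_subset[of _ "Pow M"])
  also have "\<dots> = (\<Sum>K\<in>{K. J \<subseteq> K \<and> K \<subseteq> M}. \<Sum>t\<in>Pow (K - J). (-1) ^ card t * r K)"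
    by (intro sum.cong) auto
  also have "\<dots> = (\<Sum>K\<in>{K. J \<subseteq> K \<and> K \<subseteq> M}. if K = J then r J else 0)"
  proof (rule sum.cong)
    fix K assume K: "K \<in> {K. J \<subseteq> K \<and> K \<subseteq> M}"
    then have "finite (K - J)"
      using assms(1) by (auto intro: finite_subset)
    with K show "(\<Sum>t\<in>Pow (K - J). (-1) ^ card t * r K) = (if K = J then r J else 0)"
      by (auto simp: sum_alternating_Pow simp flip: sum_distrib_right)
  qed simp
  also have "\<dots> = r J"
    using assms by (subst sum.delta) (auto intro: finite_subset[of _ "Pow M"])
  finally show ?thesis .
qed

lemma sum_rho:
  assumes "finite M"
  shows "(\<Sum>J\<in>Pow M. rho zjj w J (M - J)) = zjj"
  unfolding rho_def using sum_alternating_complements[OF assms, of "with_empty zjj w"]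
  by (simp add: with_empty_def)

text \<open>Split the subsets of \<open>insert j B\<close> by membership of \<open>j\<close>;
  adjoining \<open>j\<close> raises the cardinality by one and flips the sign.\<close>

lemma ell_insert:
  assumes "finite B" and "j \<notin> B"
  shows "ell z J (insert j B) = ell z J B - ell z (J \<union> {j}) B"
proof -
  have "inj_on (insert j) (Pow B)"
    using assms(2) by (auto simp: inj_on_def)
  moreover have "card (insert j t) = Suc (card t)" if "t \<subseteq> B" for t
    using that assms by (auto intro: card_insert_disjoint finite_subset)
  ultimately show ?thesis
    unfolding ell_def Pow_insert using assms
    by (subst sum.union_disjoint) (auto simp: sum.reindex sum_negf)
qed

text \<open>The clause for \<open>a = 0\<close> is stated separately because there
  \<open>b\<^sup>2 / a\<close> evaluates to \<open>0\<close>, so the last inequality says nothing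
  about \<open>b\<close>.\<close>

lemma quadratic_form_nonneg_iff:
  fixes a b c :: real
  shows "(\<forall>x y. 0 \<le> a * x\<^sup>2 + 2 * b * x * y + c * y\<^sup>2) \<longleftrightarrow>
    0 \<le> a \<and> (a = 0 \<longrightarrow> b = 0) \<and> b\<^sup>2 / a \<le> c"
proof
  assume nonneg [rule_format]: "\<forall>x y. 0 \<le> a * x\<^sup>2 + 2 * b * x * y + c * y\<^sup>2"
  have a: "0 \<le> a"
    using nonneg[of 1 0] by simp
  have c: "0 \<le> c"
    using nonneg[of 0 1] by simp
  show "0 \<le> a \<and> (a = 0 \<longrightarrow> b = 0) \<and> b\<^sup>2 / a \<le> c"
  proof (cases "a = 0")
    case True
    have "b = 0"
    proof (rule ccontr)
      assume "b \<noteq> 0"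
      then show False
        \<comment> \<open>With \<open>a = 0\<close> the form at \<open>(x, 1)\<close> is
          \<open>2 * b * x + c\<close>; this \<open>x\<close> makes it \<open>-1\<close>.\<close>
        using nonneg[of "- (c + 1) / (2 * b)" 1] True by simp
    qed
    with True c show ?thesis
      by simp
  next
    case False
    then have "b\<^sup>2 / a \<le> c"
      \<comment> \<open>This point minimizes the form on \<open>y = 1\<close>, with minimum
        \<open>c - b\<^sup>2 / a\<close>.\<close>
      using nonneg[of "- b / a" 1] by (simp add: power2_eq_square)
    with False a show ?thesis
      by simp
  qed
next
  assume *: "0 \<le> a \<and> (a = 0 \<longrightarrow> b = 0) \<and> b\<^sup>2 / a \<le> c"
  show "\<forall>x y. 0 \<le> a * x\<^sup>2 + 2 * b * x * y + c * y\<^sup>2"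
  proof (intro allI)
    fix x y
    show "0 \<le> a * x\<^sup>2 + 2 * b * x * y + c * y\<^sup>2"
    proof (cases "a = 0")
      case True
      with * show ?thesis
        by simp
    next
      case False
      then have "a * x\<^sup>2 + 2 * b * x * y + c * y\<^sup>2
          = a * (x + b / a * y)\<^sup>2 + (c - b\<^sup>2 / a) * y\<^sup>2"
        by (simp add: field_simps power2_eq_square)
      with * show ?thesis
        by simp
    qed
  qed
qed

lemma psd_2x2_iff:
  fixes a b c :: real
  shows "psd (vector [vector [a, b], vector [b, c]] :: real ^ 2 ^ 2) \<longleftrightarrow>
    0 \<le> a \<and> (a = 0 \<longrightarrow> b = 0) \<and> b\<^sup>2 / a \<le> c"
proof -
  let ?A = "vector [vector [a, b], vector [b, c]] :: real ^ 2 ^ 2"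
  have "transpose ?A = ?A"
    by (simp add: transpose_def vec_eq_iff forall_2)
  moreover have "x \<bullet> (?A *v x) = a * (x $ 1)\<^sup>2 + 2 * b * x $ 1 * x $ 2 + c * (x $ 2)\<^sup>2" for x
    by (simp add: inner_vec_def matrix_vector_mult_def sum_2 power2_eq_square algebra_simps)
  moreover have "(\<forall>x :: real ^ 2. P (x $ 1) (x $ 2)) \<longleftrightarrow> (\<forall>u v. P u v)" for P
    by (metis vector_2)
  ultimately show ?thesis
    unfolding psd_def quadratic_form_nonneg_iff[symmetric] by simp
qed

theorem mainTheorem5:
  fixes n j :: nat and M :: "nat set"
  assumes "n \<ge> 1"
    and "j \<in> {1..n}"
    and "M \<subseteq> {1..n} - {j}"
  shows "(\<lambda>(z, zjj, w). (z, zjj)) ` lifted_set j M = projected_set j M"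
proof (intro equalityI subsetI)
  have fin: "finite M"
    using assms(3) by (rule finite_subset) simp
  {
    fix p assume "p \<in> (\<lambda>(z, zjj, w). (z, zjj)) ` lifted_set j M"
    then obtain z zjj w where p: "p = (z, zjj)" and lifted: "(z, zjj, w) \<in> lifted_set j M"
      by auto
    have "(\<Sum>J\<in>Pow M. (ell z (J \<union> {j}) (M - J))\<^sup>2 / ell z J (M - J))
        \<le> (\<Sum>J\<in>Pow M. rho zjj w J (M - J))"
      using lifted by (intro sum_mono) (simp add: lifted_set_def psd_2x2_iff)
    with lifted show "p \<in> projected_set j M"
      unfolding sum_rho[OF fin] by (simp add: p lifted_set_def projected_set_def)
  next
    fix p assume "p \<in> projected_set j M"
    then obtain z zjj where p: "p = (z, zjj)" and proj: "(z, zjj) \<in> projected_set j M"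
      by (cases p) auto
    define a where "a J = ell z J (M - J)" for J
    define b where "b J = ell z (J \<union> {j}) (M - J)" for J
    \<comment> \<open>These are the target values for \<open>rho\<close>: each lower bound is met
      exactly, and all the slack goes to \<open>J = {}\<close> so that the total is
      \<open>zjj\<close>.\<close>
    define r where
      "r J = (b J)\<^sup>2 / a J + (if J = {} then zjj - (\<Sum>J\<in>Pow M. (b J)\<^sup>2 / a J) else 0)" for J
    \<comment> \<open>Superset sums of \<open>r\<close>, so that the alternating sums in
      \<open>rho\<close> return \<open>r\<close>. At the empty set the variable is
      \<open>zjj\<close>, which is the superset sum there by \<open>sum_r\<close>.\<close>
    define w where "w = restrict (\<lambda>S. \<Sum>K | S \<subseteq> K \<and> K \<subseteq> M. r K) (Pow M - {{}})"
    have r_ge: "(b J)\<^sup>2 / a J \<le> r J" for J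
      using proj by (simp add: r_def projected_set_def a_def b_def)
    have sum_r: "(\<Sum>K | K \<subseteq> M. r K) = zjj"
      using fin by (simp add: r_def sum.distrib Pow_def[symmetric])
    have w: "with_empty zjj w S = (\<Sum>K | S \<subseteq> K \<and> K \<subseteq> M. r K)" if "S \<subseteq> M" for S
      using that by (simp add: with_empty_def w_def sum_r)
    have rho: "rho zjj w J (M - J) = r J" if "J \<subseteq> M" for J
    proof -
      have "rho zjj w J (M - J)
          = (\<Sum>t\<in>Pow (M - J). (-1) ^ card t * (\<Sum>K | J \<union> t \<subseteq> K \<and> K \<subseteq> M. r K))"
        unfolding rho_def using that by (intro sum.cong refl) (subst w, auto)
      also have "\<dots> = r J"
        using fin that by (rule moebius_supersets)
      finally show ?thesis .
    qed
    \<comment> \<open>The linear inequalities for \<open>J \<union> {j}\<close> and for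
      \<open>J\<close> say \<open>b J \<ge> 0\<close> and \<open>a J - b J \<ge> 0\<close>. Hence
      \<open>a J = 0\<close> forces \<open>b J = 0\<close>, as semidefiniteness requires.\<close>
    have ab: "0 \<le> b J" "b J \<le> a J" if "J \<subseteq> M" for J
    proof -
      have nonneg: "0 \<le> ell z K ((M \<union> {j}) - K)" if "K \<subseteq> M \<union> {j}" for K
        using proj that by (simp add: projected_set_def)
      have "(M \<union> {j}) - (J \<union> {j}) = M - J" "(M \<union> {j}) - J = insert j (M - J)"
        using assms(3) that by auto
      moreover have "J \<union> {j} \<subseteq> M \<union> {j}" "J \<subseteq> M \<union> {j}"
        using that by auto
      ultimately have "0 \<le> ell z (J \<union> {j}) (M - J)" "0 \<le> ell z J (insert j (M - J))"
        using nonneg by metis+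
      moreover have "ell z J (insert j (M - J)) = a J - b J"
        unfolding a_def b_def using fin assms(3) by (intro ell_insert) auto
      ultimately show "0 \<le> b J" "b J \<le> a J"
        by (simp_all add: b_def)
    qed
    have "psd (vector [vector [a J, b J], vector [b J, rho zjj w J (M - J)]] :: real ^ 2 ^ 2)"
      if "J \<subseteq> M" for J
      using ab[OF that] r_ge[of J] by (auto simp: psd_2x2_iff rho[OF that])
    moreover have "w \<in> var_space M"
      by (auto simp: w_def var_space_def)
    ultimately have "(z, zjj, w) \<in> lifted_set j M"
      using proj by (simp add: lifted_set_def projected_set_def a_def b_def)
    then show "p \<in> (\<lambda>(z, zjj, w). (z, zjj)) ` lifted_set j M"
      by (force simp: p)
  }
qed

end
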